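(* Let $G=(V,E)$ be a graph on $n$ vertices and let $\{S_1,S_2,S_3\}$ be a partition of $V$. Let $p\in\{1,-1,0\}^n$ be the vector with $p_i=1$ if $v_i\in S_1$, $p_i=-1$ if $v_i\in S_2$, and $p_i=0$ if $v_i\in S_3$. Then $p$ is an eigenvector of the signless Laplacian $Q=D+A$ of $G$ for the eigenvalue $q$ if and only if $$2d_{v_i}(S_1)+d_{v_i}(S_1,S_3)=q \text{ for all } v_i\in S_1,\qquad 2d_{v_i}(S_2)+d_{v_i}(S_2,S_3)=q \text{ for all } v_i\in S_2,$$ $$d_{v_i}(S_3,S_1)-d_{v_i}(S_3,S_2)=0 \text{ for all } v_i\in S_3.$$
   Context: Graphs are finite, simple and undirected with vertex set $V=\{v_1,\dots,v_n\}$; $A$ is the adjacency matrix and $D$ the diagonal matrix of vertex degrees. For $X\subseteq V$ and $v\in X$, $d_v(X)$ is the number of neighbours of $v$ in $X$; for disjoint $X,Y\subseteq V$ and $v\in X$, $d_v(X,Y)$ is the number of neighbours of $v$ in $Y$. *)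

theory Defs
  imports "Jordan_Normal_Form.Char_Poly" "HOL-Library.Disjoint_Sets"
begin

definition simple_graph :: "'a set \<Rightarrow> 'a set set \<Rightarrow> bool" where
  "simple_graph V E \<longleftrightarrow> finite V \<and> (\<forall>e\<in>E. e \<subseteq> V \<and> card e = 2)"

definition vertex_degree :: "'a set set \<Rightarrow> 'a \<Rightarrow> nat" where
  "vertex_degree E u = card {e \<in> E. u \<in> e}"

text \<open>
  The number of neighbours of \<open>u\<close> in \<open>Y\<close>. This is \<open>d\<^sub>u(X)\<close> for \<open>Y = X \<ni> u\<close>, and
  \<open>d\<^sub>u(X, Y)\<close> for \<open>u \<in> X\<close> with \<open>Y\<close> disjoint from \<open>X\<close>: the set \<open>X\<close> only records where
  \<open>u\<close> lies.
\<close>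
definition nbrs_in :: "'a set set \<Rightarrow> 'a \<Rightarrow> 'a set \<Rightarrow> nat" where
  "nbrs_in E u Y = card {w \<in> Y. {u, w} \<in> E}"

text \<open>
  The matrices are taken with respect to an enumeration \<open>v 0, \<dots>, v (n - 1)\<close> of the vertices.
\<close>
definition adjacency_matrix :: "nat \<Rightarrow> (nat \<Rightarrow> 'a) \<Rightarrow> 'a set set \<Rightarrow> real mat" where
  "adjacency_matrix n v E = mat n n (\<lambda>(i, j). if {v i, v j} \<in> E then 1 else 0)"

definition degree_matrix :: "nat \<Rightarrow> (nat \<Rightarrow> 'a) \<Rightarrow> 'a set set \<Rightarrow> real mat" where
  "degree_matrix n v E = mat n n (\<lambda>(i, j). if i = j then real (vertex_degree E (v i)) else 0)"

definition signless_laplacian :: "nat \<Rightarrow> (nat \<Rightarrow> 'a) \<Rightarrow> 'a set set \<Rightarrow> real mat" where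
  "signless_laplacian n v E = degree_matrix n v E + adjacency_matrix n v E"

end

theory Submission imports Defs begin

text \<open>
  Entry \<open>i\<close> of \<open>Q p\<close> is the sum of \<open>p\<^sub>i + p\<^sub>j\<close> over the neighbours \<open>v\<^sub>j\<close> of \<open>v\<^sub>i\<close>. If \<open>p\<close> takes the
  constant value \<open>c X\<close> on every part \<open>X\<close> of a partition of the vertices, then each edge from a
  vertex in \<open>Y\<close> to \<open>X\<close> contributes \<open>c Y + c X\<close>, so the eigenvalue equation becomes a condition on
  the numbers of neighbours in the parts. For the values 1, -1 and 0, an edge from a vertex in one of
  the first two parts \<open>Y\<close> contributes \<open>2 c Y\<close> inside \<open>Y\<close>, nothing into the other one, and \<open>c Y\<close>
  into the third part.
\<close>

lemma vertex_degree_eq_nbrs_in: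
  assumes "simple_graph V E"
  shows "vertex_degree E u = nbrs_in E u V"
proof -
  have "bij_betw (\<lambda>w. {u, w}) {w \<in> V. {u, w} \<in> E} {e \<in> E. u \<in> e}"
  proof (rule bij_betw_imageI)
    show "inj_on (\<lambda>w. {u, w}) {w \<in> V. {u, w} \<in> E}"
      by (auto simp: inj_on_def doubleton_eq_iff)
    show "(\<lambda>w. {u, w}) ` {w \<in> V. {u, w} \<in> E} = {e \<in> E. u \<in> e}"
    proof (intro equalityI subsetI)
      fix e assume incident: "e \<in> {e \<in> E. u \<in> e}"
      with assms have "e \<subseteq> V" and "card e = 2"
        by (auto simp: simple_graph_def)
      then obtain w where "e = {u, w}"
        using incident by (auto simp: card_2_iff)
      with incident \<open>e \<subseteq> V\<close> show "e \<in> (\<lambda>w. {u, w}) ` {w \<in> V. {u, w} \<in> E}"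
        by auto
    qed auto
  qed
  then show ?thesis
    by (simp add: vertex_degree_def nbrs_in_def bij_betw_same_card)
qed

lemma nbrs_in_eq_card_indices:
  assumes "bij_betw v I V" and "X \<subseteq> V"
  shows "nbrs_in E u X = card {j \<in> I. v j \<in> X \<and> {u, v j} \<in> E}"
proof -
  have "bij_betw v {j \<in> I. v j \<in> X \<and> {u, v j} \<in> E} {w \<in> X. {u, w} \<in> E}"
  proof (rule bij_betw_subset[OF assms(1)])
    show "v ` {j \<in> I. v j \<in> X \<and> {u, v j} \<in> E} = {w \<in> X. {u, w} \<in> E}"
      using bij_betw_imp_surj_on[OF assms(1)] assms(2) by blast
  qed auto
  then show ?thesis
    by (simp add: nbrs_in_def bij_betw_same_card)
qed

lemma vertex_degree_eq_card_indices:
  assumes "simple_graph V E" and "bij_betw v I V"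
  shows "vertex_degree E u = card {j \<in> I. {u, v j} \<in> E}"
proof -
  have "{j \<in> I. v j \<in> V \<and> {u, v j} \<in> E} = {j \<in> I. {u, v j} \<in> E}"
    using bij_betwE[OF assms(2)] by blast
  then show ?thesis
    by (simp add: vertex_degree_eq_nbrs_in[OF assms(1)] nbrs_in_eq_card_indices[OF assms(2)])
qed

lemma signless_laplacian_carrier: "signless_laplacian n v E \<in> carrier_mat n n"
  by (simp add: signless_laplacian_def degree_matrix_def adjacency_matrix_def)

lemma signless_laplacian_mult_vec_nth:
  assumes "simple_graph V E" and "bij_betw v {..<n} V"
    and "p \<in> carrier_vec n" and "i < n"
  shows "(signless_laplacian n v E *\<^sub>v p) $ i =
    (\<Sum>j\<in>{j \<in> {..<n}. {v i, v j} \<in> E}. p $ i + p $ j)"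
proof -
  let ?N = "{j \<in> {..<n}. {v i, v j} \<in> E}"
  have "(signless_laplacian n v E *\<^sub>v p) $ i =
      (\<Sum>j<n. ((if i = j then real (vertex_degree E (v i)) else 0) +
        (if {v i, v j} \<in> E then 1 else 0)) * p $ j)"
    using assms(3,4)
    by (auto simp: signless_laplacian_def degree_matrix_def adjacency_matrix_def scalar_prod_def
        atLeast0LessThan intro!: sum.cong)
  also have "\<dots> = (\<Sum>j<n. if i = j then real (vertex_degree E (v i)) * p $ j else 0) +
      (\<Sum>j<n. if {v i, v j} \<in> E then p $ j else 0)"
    unfolding sum.distrib[symmetric] by (intro sum.cong) (auto simp: distrib_right)
  also have "\<dots> = real (card ?N) * p $ i + (\<Sum>j\<in>?N. p $ j)"
    using assms(4)
    by (subst sum.inter_filter) (simp_all add: vertex_degree_eq_card_indices[OF assms(1,2)])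
  finally show ?thesis
    by (simp add: sum.distrib)
qed

lemma sum_neighbours_partition:
  fixes g :: "'a set \<Rightarrow> 'b::semiring_1"
  assumes "bij_betw v I V" and "finite I" and "partition_on V P"
    and const: "\<And>X j. X \<in> P \<Longrightarrow> j \<in> I \<Longrightarrow> v j \<in> X \<Longrightarrow> f j = g X"
  shows "(\<Sum>j\<in>{j \<in> I. {u, v j} \<in> E}. f j) = (\<Sum>X\<in>P. of_nat (nbrs_in E u X) * g X)"
proof -
  define N where "N X = {j \<in> I. v j \<in> X \<and> {u, v j} \<in> E}" for X
  have image: "v ` I = \<Union>P"
    using assms(1,3) by (simp add: bij_betw_def partition_on_def)
  have "finite P"
    using assms(1-3) bij_betw_finite finite_elements by blast
  have disjoint: "N X \<inter> N Y = {}" if "X \<in> P" "Y \<in> P" "X \<noteq> Y" for X Y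
    using partition_onD2[OF assms(3)] that by (auto simp: N_def disjoint_def)
  have "{j \<in> I. {u, v j} \<in> E} = (\<Union>X\<in>P. N X)"
    using image by (auto simp: N_def)
  then have "(\<Sum>j\<in>{j \<in> I. {u, v j} \<in> E}. f j) = (\<Sum>X\<in>P. \<Sum>j\<in>N X. f j)"
    using \<open>finite P\<close> \<open>finite I\<close> disjoint
    by (simp add: sum.UNION_disjoint N_def)
  also have "\<dots> = (\<Sum>X\<in>P. of_nat (card (N X)) * g X)"
    by (simp add: N_def const)
  also have "\<dots> = (\<Sum>X\<in>P. of_nat (nbrs_in E u X) * g X)"
  proof (intro sum.cong refl)
    fix X assume "X \<in> P"
    then have "X \<subseteq> V"
      using partition_onD1[OF assms(3)] by blast
    from nbrs_in_eq_card_indices[OF assms(1) this]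
    show "of_nat (card (N X)) * g X = of_nat (nbrs_in E u X) * g X"
      by (simp add: N_def)
  qed
  finally show ?thesis .
qed

lemma ball_indices_iff_ball_parts:
  assumes "bij_betw v I V" and "partition_on V P"
    and iff: "\<And>X i. X \<in> P \<Longrightarrow> i \<in> I \<Longrightarrow> v i \<in> X \<Longrightarrow> R i \<longleftrightarrow> S X (v i)"
  shows "(\<forall>i\<in>I. R i) \<longleftrightarrow> (\<forall>X\<in>P. \<forall>u\<in>X. S X u)"
proof -
  have image: "v ` I = \<Union>P"
    using assms(1,2) by (simp add: bij_betw_def partition_on_def)
  show ?thesis
  proof (intro iffI ballI)
    fix X u assume "\<forall>i\<in>I. R i" and "X \<in> P" and "u \<in> X"
    then have "u \<in> v ` I"
      unfolding image by blast
    then obtain i where "i \<in> I" "u = v i" by blast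
    with \<open>\<forall>i\<in>I. R i\<close> \<open>X \<in> P\<close> \<open>u \<in> X\<close> show "S X u"
      using iff by blast
  next
    fix i assume parts: "\<forall>X\<in>P. \<forall>u\<in>X. S X u" and "i \<in> I"
    then have "v i \<in> \<Union>P"
      unfolding image[symmetric] by blast
    then obtain X where "X \<in> P" "v i \<in> X" by blast
    with parts \<open>i \<in> I\<close> show "R i"
      using iff by blast
  qed
qed

lemma partition_constant_vec_eq_0_iff:
  assumes "bij_betw v {..<n} V" and "partition_on V P" and "p \<in> carrier_vec n"
    and const: "\<And>X i. X \<in> P \<Longrightarrow> i < n \<Longrightarrow> v i \<in> X \<Longrightarrow> p $ i = c X"
  shows "p = 0\<^sub>v n \<longleftrightarrow> (\<forall>X\<in>P. c X = 0)"
proof -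
  have "p = 0\<^sub>v n \<longleftrightarrow> (\<forall>i\<in>{..<n}. p $ i = 0)"
    using assms(3) by (auto simp: vec_eq_iff)
  also have "\<dots> \<longleftrightarrow> (\<forall>X\<in>P. \<forall>u\<in>X. c X = 0)"
    using const by (intro ball_indices_iff_ball_parts[OF assms(1,2)]) simp
  also have "\<dots> \<longleftrightarrow> (\<forall>X\<in>P. c X = 0)"
    using partition_onD3[OF assms(2)] by (metis all_not_in_conv)
  finally show ?thesis .
qed

lemma signless_laplacian_mult_partition_constant_vec_nth:
  assumes "simple_graph V E" and "bij_betw v {..<n} V"
    and "partition_on V P" and "p \<in> carrier_vec n"
    and const: "\<And>X i. X \<in> P \<Longrightarrow> i < n \<Longrightarrow> v i \<in> X \<Longrightarrow> p $ i = c X"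
    and "Y \<in> P" and "i < n" and "v i \<in> Y"
  shows "(signless_laplacian n v E *\<^sub>v p) $ i =
    (\<Sum>X\<in>P. real (nbrs_in E (v i) X) * (c Y + c X))"
  unfolding signless_laplacian_mult_vec_nth[OF assms(1,2,4) \<open>i < n\<close>]
proof (rule sum_neighbours_partition[OF assms(2) _ assms(3)])
  show "p $ i + p $ j = c Y + c X" if "X \<in> P" "j \<in> {..<n}" "v j \<in> X" for X j
    using const[OF \<open>Y \<in> P\<close> \<open>i < n\<close> \<open>v i \<in> Y\<close>] const[of X j] that by simp
qed simp

lemma eigenvector_signless_laplacian_partition_iff:
  assumes "simple_graph V E" and "bij_betw v {..<n} V"
    and "partition_on V P" and "p \<in> carrier_vec n"
    and const: "\<And>X i. X \<in> P \<Longrightarrow> i < n \<Longrightarrow> v i \<in> X \<Longrightarrow> p $ i = c X"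
  shows "eigenvector (signless_laplacian n v E) p q \<longleftrightarrow>
    (\<exists>X\<in>P. c X \<noteq> 0) \<and>
    (\<forall>Y\<in>P. \<forall>u\<in>Y. (\<Sum>X\<in>P. real (nbrs_in E u X) * (c Y + c X)) = q * c Y)"
proof -
  let ?Q = "signless_laplacian n v E"
  have "?Q *\<^sub>v p = q \<cdot>\<^sub>v p \<longleftrightarrow> (\<forall>i\<in>{..<n}. (?Q *\<^sub>v p) $ i = q * p $ i)"
    using assms(4) signless_laplacian_carrier[of n v E] by (auto simp: vec_eq_iff)
  also have "\<dots> \<longleftrightarrow> (\<forall>Y\<in>P. \<forall>u\<in>Y.
      (\<Sum>X\<in>P. real (nbrs_in E u X) * (c Y + c X)) = q * c Y)"
  proof (rule ball_indices_iff_ball_parts[OF assms(2,3)])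
    fix Y i assume "Y \<in> P" "i \<in> {..<n}" "v i \<in> Y"
    then have index: "i < n" by simp
    show "(?Q *\<^sub>v p) $ i = q * p $ i \<longleftrightarrow>
        (\<Sum>X\<in>P. real (nbrs_in E (v i) X) * (c Y + c X)) = q * c Y"
      using signless_laplacian_mult_partition_constant_vec_nth
          [OF assms \<open>Y \<in> P\<close> index \<open>v i \<in> Y\<close>]
        const[OF \<open>Y \<in> P\<close> index \<open>v i \<in> Y\<close>]
      by simp
  qed
  finally have equation: "?Q *\<^sub>v p = q \<cdot>\<^sub>v p \<longleftrightarrow> \<dots>" .
  have "p \<noteq> 0\<^sub>v n \<longleftrightarrow> (\<exists>X\<in>P. c X \<noteq> 0)"
    using partition_constant_vec_eq_0_iff[OF assms(2-4) const] by simp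
  with equation show ?thesis
    using assms(4) signless_laplacian_carrier[of n v E] by (simp add: eigenvector_def)
qed

theorem theorem2p6:
  fixes V :: "'a set" and E :: "'a set set" and n :: nat and v :: "nat \<Rightarrow> 'a"
    and S1 S2 S3 :: "'a set" and p :: "real vec" and q :: real
  assumes "simple_graph V E"
    and "bij_betw v {..<n} V"
    and "partition_on V {S1, S2, S3}" and "distinct [S1, S2, S3]"
    and "p \<in> carrier_vec n"
    and "\<And>i. i < n \<Longrightarrow> v i \<in> S1 \<Longrightarrow> p $ i = 1"
    and "\<And>i. i < n \<Longrightarrow> v i \<in> S2 \<Longrightarrow> p $ i = -1"
    and "\<And>i. i < n \<Longrightarrow> v i \<in> S3 \<Longrightarrow> p $ i = 0"
  shows "eigenvector (signless_laplacian n v E) p q \<longleftrightarrow>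
    (\<forall>u\<in>S1. 2 * real (nbrs_in E u S1) + real (nbrs_in E u S3) = q) \<and>
    (\<forall>u\<in>S2. 2 * real (nbrs_in E u S2) + real (nbrs_in E u S3) = q) \<and>
    (\<forall>u\<in>S3. real (nbrs_in E u S1) - real (nbrs_in E u S2) = 0)"
proof -
  define c :: "'a set \<Rightarrow> real" where
    "c = (\<lambda>X. if X = S1 then 1 else if X = S2 then -1 else 0)"
  have c_values: "c S1 = 1" "c S2 = -1" "c S3 = 0"
    using assms(4) by (auto simp: c_def)
  have "p $ i = c X" if "X \<in> {S1, S2, S3}" "i < n" "v i \<in> X" for X i
    using that assms(6-8) c_values by auto
  from eigenvector_signless_laplacian_partition_iff[OF assms(1-3,5) this]
  have "eigenvector (signless_laplacian n v E) p q \<longleftrightarrow>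
      (\<forall>Y\<in>{S1, S2, S3}. \<forall>u\<in>Y.
        (\<Sum>X\<in>{S1, S2, S3}. real (nbrs_in E u X) * (c Y + c X)) = q * c Y)"
    by (simp add: c_values)
  also have "\<dots> \<longleftrightarrow>
      (\<forall>u\<in>S1. 2 * real (nbrs_in E u S1) + real (nbrs_in E u S3) = q) \<and>
      (\<forall>u\<in>S2. - 2 * real (nbrs_in E u S2) - real (nbrs_in E u S3) = - q) \<and>
      (\<forall>u\<in>S3. real (nbrs_in E u S1) - real (nbrs_in E u S2) = 0)"
    using assms(4) by (simp add: c_values mult.commute)
  also have "(\<forall>u\<in>S2. - 2 * real (nbrs_in E u S2) - real (nbrs_in E u S3) = - q) \<longleftrightarrow>
      (\<forall>u\<in>S2. 2 * real (nbrs_in E u S2) + real (nbrs_in E u S3) = q)"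
    by (intro ball_cong refl) linarith
  finally show ?thesis .
qed

end
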